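(* Let $\mathbf w_1,\dots,\mathbf w_{n+1}\in\mathbb R^n$ be a regular simplex frame and let $\mathcal S=\sum_{i=1}^{n+1}\mathbf w_i^{\circ m}$ be the associated regular simplex tensor of order $m$ and dimension $n$. Then the robust eigenvectors of $\mathcal S$ are precisely the vectors in the frame, $\mathbf w_1,\dots,\mathbf w_{n+1}$.
   Context: Here $n\ge 2$ and $m\ge 3$ are integers. A regular simplex frame in $\mathbb R^n$ is a collection of $n+1$ unit vectors $\mathbf w_1,\dots,\mathbf w_{n+1}\in\mathbb R^n$ with $\langle \mathbf w_i,\mathbf w_j\rangle=-\frac1n$ for all $i\neq j$ and $\sum_{i=1}^{n+1}\mathbf w_i\mathbf w_i^{\mathrm T}=\frac{n+1}{n}\mathbf I_n$. For $\mathbf a\in\mathbb R^n$, $\mathbf a^{\circ m}$ is the $m$th-order $n$-dimensional symmetric tensor with entries $a_{i_1}a_{i_2}\cdots a_{i_m}$. For a real symmetric tensor $\mathcal S=(s_{i_1,\dots,i_m})$ of order $m$ and dimension $n$ and $\mathbf v\in\mathbb R^n$, $\mathcal S\mathbf v^{m-1}\in\mathbb R^n$ has $j$th entry $\sum_{i_2,\dots,i_m=1}^n s_{j,i_2,\dots,i_m}v_{i_2}\cdots v_{i_m}$, and $\mathcal S\mathbf v^{m-2}\in\mathbb R^{n\times n}$ has $(i,j)$ entry $\sum_{i_3,\dots,i_m=1}^n s_{i,j,i_3,\dots,i_m}v_{i_3}\cdots v_{i_m}$. A (real) eigenpair of $\mathcal S$ is a pair $(\lambda,\mathbf v)\in\mathbb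 R\times\mathbb R^n$ with $\mathcal S\mathbf v^{m-1}=\lambda\mathbf v$ and $\mathbf v^{\mathrm T}\mathbf v=1$; then $\mathbf v$ is called an eigenvector. If $(\lambda,\mathbf v)$ is an eigenpair then so is $(-\lambda,-\mathbf v)$ when $m$ is odd, and so is $(\lambda,-\mathbf v)$ when $m$ is even. Accordingly, for odd $m$ only eigenpairs with nonnegative eigenvalue are considered, and for even $m$ the eigenvectors $\mathbf v$ and $-\mathbf v$ are identified. Robustness: the tensor power method iterates the map $\phi(\mathbf v)=\mathcal S\mathbf v^{m-1}/\|\mathcal S\mathbf v^{m-1}\|$. An eigenvector $\mathbf v$ with eigenvalue $\lambda\ne0$ is called robust if it is an attracting fixed point of the tensor power method, which is checked by the condition that the Jacobian matrix of $\phi$ at $\mathbf v$, namely $\mathbf J(\mathbf v)=\frac{m-1}{\lambda}\left(\mathcal S\mathbf v^{m-2}-\lambda\mathbf v\mathbf v^{\mathrm T}\right)$, has spectral radius (maximum absolute value of its eigenvalues) strictly less than $1$.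
   Formalization: The pairs (n,m) = (2,3), (2,4), (3,3) are excluded: there the Jacobian at each frame vector acts on its orthogonal complement as the scalar -2, 1, -1 respectively, so the frame vectors are not robust and the claim is false. *)

theory Defs
  imports "Jordan_Normal_Form.Spectral_Radius"
begin

text \<open>A tensor of order \<open>m\<close> and dimension \<open>n\<close> is a function on index lists; only its values on
  lists of length \<open>m\<close> with entries in \<open>{0..<n}\<close> are ever used.  Coordinates are counted from 0,
  as in \<open>Jordan_Normal_Form.Matrix\<close>, while frame vectors are indexed by \<open>{1..n+1}\<close>.\<close>

type_synonym tensor = "nat list \<Rightarrow> real"

definition index_lists :: "nat \<Rightarrow> nat \<Rightarrow> nat list set" where
  "index_lists n k = {is. set is \<subseteq> {0..<n} \<and> length is = k}"

definition outer :: "nat \<Rightarrow> real vec \<Rightarrow> real mat" where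
  "outer n v = mat n n (\<lambda>(i, j). v $ i * v $ j)"

definition simplex_frame :: "nat \<Rightarrow> (nat \<Rightarrow> real vec) \<Rightarrow> bool" where
  "simplex_frame n w \<longleftrightarrow>
     (\<forall>i \<in> {1..n+1}. w i \<in> carrier_vec n) \<and>
     (\<forall>i \<in> {1..n+1}. w i \<bullet> w i = 1) \<and>
     (\<forall>i \<in> {1..n+1}. \<forall>j \<in> {1..n+1}. i \<noteq> j \<longrightarrow> w i \<bullet> w j = - 1 / real n) \<and>
     mat n n (\<lambda>(r, c). \<Sum>i = 1..n+1. outer n (w i) $$ (r, c)) = ((real n + 1) / real n) \<cdot>\<^sub>m 1\<^sub>m n"

text \<open>The order of \<open>a\<^sup>\<circ>\<^sup>m\<close> is the length of the index list.\<close>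

definition rank_one_tensor :: "real vec \<Rightarrow> tensor" where
  "rank_one_tensor a = (\<lambda>is. \<Prod>k\<leftarrow>is. a $ k)"

definition simplex_tensor :: "nat \<Rightarrow> (nat \<Rightarrow> real vec) \<Rightarrow> tensor" where
  "simplex_tensor n w = (\<lambda>is. \<Sum>i = 1..n+1. rank_one_tensor (w i) is)"

definition tensor_vec :: "nat \<Rightarrow> nat \<Rightarrow> tensor \<Rightarrow> real vec \<Rightarrow> real vec" where
  "tensor_vec n m S v =
     vec n (\<lambda>j. \<Sum>is \<in> index_lists n (m - 1). S (j # is) * (\<Prod>k\<leftarrow>is. v $ k))"

definition tensor_mat :: "nat \<Rightarrow> nat \<Rightarrow> tensor \<Rightarrow> real vec \<Rightarrow> real mat" where
  "tensor_mat n m S v =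
     mat n n (\<lambda>(i, j). \<Sum>is \<in> index_lists n (m - 2). S (i # j # is) * (\<Prod>k\<leftarrow>is. v $ k))"

definition eigenpair :: "nat \<Rightarrow> nat \<Rightarrow> tensor \<Rightarrow> real \<Rightarrow> real vec \<Rightarrow> bool" where
  "eigenpair n m S l v \<longleftrightarrow>
     v \<in> carrier_vec n \<and> tensor_vec n m S v = l \<cdot>\<^sub>v v \<and> v \<bullet> v = 1"

text \<open>Jacobian at \<open>v\<close> of the tensor power iteration \<open>v \<mapsto> S v\<^sup>m\<^sup>-\<^sup>1 / \<parallel>S v\<^sup>m\<^sup>-\<^sup>1\<parallel>\<close>, for an
  eigenpair \<open>(l, v)\<close> with \<open>l \<noteq> 0\<close>.\<close>

definition power_jacobian :: "nat \<Rightarrow> nat \<Rightarrow> tensor \<Rightarrow> real \<Rightarrow> real vec \<Rightarrow> real mat" where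
  "power_jacobian n m S l v =
     ((real m - 1) / l) \<cdot>\<^sub>m (tensor_mat n m S v - l \<cdot>\<^sub>m outer n v)"

text \<open>Sign convention for odd order: only eigenpairs with nonnegative eigenvalue are considered.\<close>

definition robust_eigenvector :: "nat \<Rightarrow> nat \<Rightarrow> tensor \<Rightarrow> real vec \<Rightarrow> bool" where
  "robust_eigenvector n m S v \<longleftrightarrow>
     (\<exists>l. eigenpair n m S l v \<and> (odd m \<longrightarrow> 0 \<le> l) \<and> l \<noteq> 0 \<and>
          spectral_radius (map_mat complex_of_real (power_jacobian n m S l v)) < 1)"

text \<open>Sign convention for even order: \<open>v\<close> and \<open>-v\<close> are identified.\<close>

definition same_eigenvector :: "nat \<Rightarrow> real vec \<Rightarrow> real vec \<Rightarrow> bool" where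
  "same_eigenvector m u v \<longleftrightarrow> u = v \<or> (even m \<and> u = - v)"

text \<open>At a frame vector the Jacobian vanishes on the vector itself and acts on its orthogonal
  complement as the scalar \<open>(m-1) (-1/n)\<^sup>m\<^sup>-\<^sup>2 ((n+1)/n) / (1 - (-1/n)\<^sup>m\<^sup>-\<^sup>1)\<close>.  For \<open>n \<ge> 2\<close>, \<open>m \<ge> 3\<close>
  its modulus is at least 1 exactly for the three pairs \<open>(n, m)\<close> = (2,3), (2,4), (3,3), with
  values -2, 1 and -1; there the frame vectors are eigenvectors but not robust, so these pairs
  must be excluded when robust eigenvectors are compared with the frame.\<close>

end

theory Submission
  imports Defs
begin

text \<open>
  Put \<open>x\<^sub>k = \<langle>w\<^sub>k, v\<rangle>\<close>. These \<open>n + 1\<close> numbers determine \<open>v\<close>, sum to zero, and have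
  \<open>\<Sum> x\<^sub>k\<^sup>2 = (n + 1) / n\<close> for a unit vector. In these coordinates the eigenvector equation says that every
  \<open>x\<^sub>k\<close> is a root of one trinomial \<open>f(x) = x\<^sup>p - \<mu> x - c\<close>, where \<open>p = m - 1\<close> and
  \<open>\<mu> = n \<lambda> / (n + 1)\<close> (\<open>eigenpair_coordinates\<close>), and the sign conventions force \<open>\<mu> > 0\<close>.

  Robustness is a second-order condition. The Jacobian is real symmetric, so spectral radius below 1
  bounds its quadratic form by the identity (\<open>symmetric_quadratic_form_less\<close>). For test vectors
  \<open>\<Sum> y\<^sub>k w\<^sub>k\<close> orthogonal to \<open>v\<close> this reads \<open>\<Sum> f'(x\<^sub>k) y\<^sub>k\<^sup>2 < 0\<close> whenever \<open>\<Sum> y\<^sub>k = \<Sum> x\<^sub>k y\<^sub>k = 0\<close>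
  and \<open>y \<noteq> 0\<close> (\<open>robust_second_order\<close>). Two kinds of test vector suffice
  (\<open>one_exceptional_coordinate\<close>):
  \<^item> If a value \<open>r\<close> is taken twice, the difference of the two positions gives \<open>f'(r) < 0\<close>, and the
    trinomial cannot be strictly decreasing at two different roots
    (\<open>trinomial_roots_not_both_descending\<close>); so at most one value is repeated.
  \<^item> If three distinct values \<open>r\<^sub>1 < r\<^sub>2 < r\<^sub>3\<close> occur, the weights \<open>r\<^sub>3 - r\<^sub>2\<close>, \<open>r\<^sub>1 - r\<^sub>3\<close>,
    \<open>r\<^sub>2 - r\<^sub>1\<close> at three such positions give a sum that is in fact nonnegative for odd \<open>p\<close>
    (\<open>trinomial_weighted_slopes_nonneg\<close>); for even \<open>p\<close> the trinomial has at most two roots anyway.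

  Hence all \<open>x\<^sub>k\<close> but one, \<open>x\<^sub>i\<close>, agree. The two moment identities leave only \<open>x\<^sub>i = \<plusminus>1\<close> and
  \<open>x\<^sub>k = -x\<^sub>i / n\<close> otherwise, that is \<open>v = \<plusminus>w\<^sub>i\<close>; for odd \<open>m\<close> the minus sign contradicts \<open>\<mu> > 0\<close>.

  Conversely, at \<open>\<plusminus>w\<^sub>i\<close> the Jacobian is \<open>\<kappa>\<close> times the projection onto the orthogonal complement of
  \<open>w\<^sub>i\<close>, and \<open>\<bar>\<kappa>\<bar> < 1\<close> follows from \<open>p (n + 1) + 1 < n\<^sup>p\<close>, which fails only for the excluded pairs
  (\<open>linear_less_power\<close>).
\<close>

section \<open>Trinomials and powers\<close>

lemma poly_Rolle:
  fixes F :: "real poly"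
  assumes "a < b" "poly F a = 0" "poly F b = 0"
  obtains x where "a < x" "x < b" "poly (pderiv F) x = 0"
  using poly_MVT[OF assms(1), of F] assms by auto

definition trinomial :: "nat \<Rightarrow> real \<Rightarrow> real \<Rightarrow> real poly" where
  "trinomial p \<mu> c = monom 1 p - [:c, \<mu>:]"

lemma poly_trinomial: "poly (trinomial p \<mu> c) x = x ^ p - \<mu> * x - c"
  by (simp add: trinomial_def poly_monom)

lemma poly_pderiv_trinomial: "poly (pderiv (trinomial p \<mu> c)) x = real p * x ^ (p - 1) - \<mu>"
  by (simp add: trinomial_def poly_monom pderiv_diff pderiv_monom pderiv_pCons)

lemma trinomial_critical_point:
  fixes a b :: real
  assumes "a < b" "a ^ p = \<mu> * a + c" "b ^ p = \<mu> * b + c"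
  obtains x where "a < x" "x < b" "real p * x ^ (p - 1) = \<mu>"
proof -
  obtain x where "a < x" "x < b" "poly (pderiv (trinomial p \<mu> c)) x = 0"
    by (rule poly_Rolle[OF assms(1), of "trinomial p \<mu> c"]) (auto simp: poly_trinomial assms)
  then show ?thesis by (intro that) (auto simp: poly_pderiv_trinomial)
qed

text \<open>Between two roots there is a critical point \<open>x\<close>, and the derivative \<open>p x\<^sup>p\<^sup>-\<^sup>1 - \<mu>\<close> is negative only on an
  interval, since a power function on a segment attains its maximum at an endpoint.\<close>

lemma trinomial_roots_not_both_descending:
  fixes a b :: real
  assumes "a < b" "a ^ p = \<mu> * a + c" "b ^ p = \<mu> * b + c"
  shows "real p * a ^ (p - 1) \<ge> \<mu> \<or> real p * b ^ (p - 1) \<ge> \<mu>"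
proof -
  obtain x where x: "a < x" "x < b" "real p * x ^ (p - 1) = \<mu>"
    using trinomial_critical_point[OF assms] .
  have "x ^ (p - 1) \<le> a ^ (p - 1) \<or> x ^ (p - 1) \<le> b ^ (p - 1)"
  proof (cases "even (p - 1)")
    case True
    have "\<bar>x\<bar> \<le> \<bar>a\<bar> \<or> \<bar>x\<bar> \<le> \<bar>b\<bar>" using x by linarith
    then show ?thesis using True by (meson power_mono_even)
  next
    case False
    then show ?thesis using x power_mono_odd[of "p - 1" x b] by auto
  qed
  then show ?thesis using x(3) by (metis mult_left_mono of_nat_0_le_iff)
qed

text \<open>By Rolle, a third root would give two critical points, but odd powers are injective.\<close>

lemma trinomial_even_two_roots:
  fixes r1 r2 r3 :: real
  assumes "even p" "p \<ge> 2" "r1 < r2" "r2 < r3"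
    and "r1 ^ p = \<mu> * r1 + c" "r2 ^ p = \<mu> * r2 + c" "r3 ^ p = \<mu> * r3 + c"
  shows False
proof -
  obtain x where x: "r1 < x" "x < r2" "real p * x ^ (p - 1) = \<mu>"
    using trinomial_critical_point[OF assms(3,5,6)] .
  obtain y where y: "r2 < y" "y < r3" "real p * y ^ (p - 1) = \<mu>"
    using trinomial_critical_point[OF assms(4,6,7)] .
  have "odd (p - 1)" using assms(1,2) by auto
  moreover have "x ^ (p - 1) = y ^ (p - 1)"
    using x(3) y(3) assms(2) by (metis mult_left_cancel not_numeral_le_zero of_nat_eq_0_iff)
  ultimately have "x = y"
    by (metis odd_real_root_power_cancel)
  then show False using x y by simp
qed

text \<open>Up to the positive factor \<open>((r\<^sub>1 - r\<^sub>2) (r\<^sub>1 - r\<^sub>3) (r\<^sub>2 - r\<^sub>3))\<^sup>2\<close>, the weighted sum of slopes is the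
  fifth divided difference of \<open>f\<close> at the doubled nodes \<open>r\<^sub>1, r\<^sub>1, r\<^sub>2, r\<^sub>2, r\<^sub>3, r\<^sub>3\<close>. It ought to
  have the sign of the fifth derivative, which is nonnegative because \<open>p\<close> is odd. The proof subtracts the
  quintic Hermite interpolant, whose leading coefficient \<open>K\<close> is that divided difference, and applies Rolle
  four times. Stopping at the fourth derivative is convenient: it is a nonnegative multiple
  of an odd power minus a linear function of slope \<open>120 K\<close>, hence strictly increasing if \<open>K < 0\<close>.\<close>

lemma trinomial_weighted_slopes_nonneg:
  fixes r1 r2 r3 :: real
  assumes "odd p" "p \<ge> 3" "r1 < r2" "r2 < r3"
    and "r1 ^ p = \<mu> * r1 + c" "r2 ^ p = \<mu> * r2 + c" "r3 ^ p = \<mu> * r3 + c"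
  shows "(real p * r1 ^ (p - 1) - \<mu>) * (r3 - r2)\<^sup>2 + (real p * r2 ^ (p - 1) - \<mu>) * (r1 - r3)\<^sup>2
       + (real p * r3 ^ (p - 1) - \<mu>) * (r2 - r1)\<^sup>2 \<ge> 0" (is "?L \<ge> 0")
proof (rule ccontr)
  assume neg: "\<not> ?L \<ge> 0"
  let ?f = "trinomial p \<mu> c"
  define d where "d r = poly (pderiv ?f) r" for r
  \<comment> \<open>The interpolant is \<open>W * Q\<close>: it vanishes at the nodes because \<open>W\<close> does, and it has the slopes of
    \<open>f\<close> there when the quadratic \<open>Q\<close>, in Newton form, takes the values \<open>e1\<close>, \<open>e2\<close>, \<open>e3\<close>.\<close>
  define W where "W = [:- r1, 1:] * [:- r2, 1:] * [:- r3, 1:]"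
  define e1 where "e1 = d r1 / ((r1 - r2) * (r1 - r3))"
  define e2 where "e2 = d r2 / ((r2 - r1) * (r2 - r3))"
  define e3 where "e3 = d r3 / ((r3 - r1) * (r3 - r2))"
  define K where "K = e1 / ((r1 - r2) * (r1 - r3)) + e2 / ((r2 - r1) * (r2 - r3)) + e3 / ((r3 - r1) * (r3 - r2))"
  define s where "s = (e2 - e1) / (r2 - r1)"
  define Q where "Q = [:e1 - s * r1 + K * r1 * r2, s - K * (r1 + r2), K:]"
  define F where "F = ?f - W * Q"
  have ne: "r1 - r2 \<noteq> 0" "r2 - r1 \<noteq> 0" "r1 - r3 \<noteq> 0" "r3 - r1 \<noteq> 0" "r2 - r3 \<noteq> 0" "r3 - r2 \<noteq> 0"
    using assms by auto
  have K: "K < 0"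
  proof -
    have "?L = K * ((r1 - r2) * (r1 - r3) * (r2 - r3))\<^sup>2"
    proof -
      have sq: "t / q / q * (q * z)\<^sup>2 = t * z\<^sup>2" if "q \<noteq> 0" for t q z :: real
        using that by (simp add: power2_eq_square)
      let ?P = "((r1 - r2) * (r1 - r3) * (r2 - r3))\<^sup>2"
      have P: "?P = ((r1 - r2) * (r1 - r3) * (r3 - r2))\<^sup>2" "?P = ((r2 - r1) * (r2 - r3) * (r1 - r3))\<^sup>2"
        "?P = ((r3 - r1) * (r3 - r2) * (r2 - r1))\<^sup>2"
        by (simp_all add: power_mult_distrib power2_commute[of r3 r2] power2_commute[of r2 r1]
            power2_commute[of r3 r1])
      have 1: "e1 / ((r1 - r2) * (r1 - r3)) * ?P = d r1 * (r3 - r2)\<^sup>2"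
        unfolding e1_def P(1) by (rule sq) (use ne in simp)
      have 2: "e2 / ((r2 - r1) * (r2 - r3)) * ?P = d r2 * (r1 - r3)\<^sup>2"
        unfolding e2_def P(2) by (rule sq) (use ne in simp)
      have 3: "e3 / ((r3 - r1) * (r3 - r2)) * ?P = d r3 * (r2 - r1)\<^sup>2"
        unfolding e3_def P(3) by (rule sq) (use ne in simp)
      show ?thesis
        using 1 2 3 unfolding K_def by (simp add: d_def poly_pderiv_trinomial distrib_right)
    qed
    then show ?thesis using neg by (metis linorder_not_le mult_nonneg_nonneg zero_le_power2)
  qed
  have Qv: "poly Q r1 = e1" "poly Q r2 = e2" "poly Q r3 = e3"
  proof -
    show "poly Q r1 = e1" unfolding Q_def by (simp add: algebra_simps)
    have newton: "poly Q x = e1 + s * (x - r1) + K * (x - r1) * (x - r2)" for x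
      unfolding Q_def by (simp add: algebra_simps)
    show "poly Q r2 = e2" unfolding newton s_def using ne by simp
    have "K * (r3 - r1) * (r3 - r2) = e1 * (r3 - r2) / (r2 - r1) - e2 * (r3 - r1) / (r2 - r1) + e3"
    proof -
      have "e1 / ((r1 - r2) * (r1 - r3)) * ((r3 - r1) * (r3 - r2)) = e1 * (r3 - r2) / (r2 - r1)"
        using ne by (simp add: divide_simps) (simp add: algebra_simps)
      moreover have "e2 / ((r2 - r1) * (r2 - r3)) * ((r3 - r1) * (r3 - r2)) = - (e2 * (r3 - r1) / (r2 - r1))"
        using ne by (simp add: divide_simps) (simp add: algebra_simps)
      moreover have "e3 / ((r3 - r1) * (r3 - r2)) * ((r3 - r1) * (r3 - r2)) = e3"
        using ne by simp
      ultimately show ?thesis unfolding K_def by (simp only: mult.assoc distrib_right)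
    qed
    moreover have "s * (r3 - r1) = e2 * (r3 - r1) / (r2 - r1) - e1 * (r3 - r1) / (r2 - r1)"
      unfolding s_def by (simp add: left_diff_distrib diff_divide_distrib)
    moreover have "e1 * (r3 - r1) / (r2 - r1) = e1 * (r3 - r2) / (r2 - r1) + e1"
      using ne by (simp add: divide_simps) (simp add: algebra_simps)
    ultimately show "poly Q r3 = e3" unfolding newton by simp
  qed
  have Wv: "poly (pderiv W) r1 = (r1 - r2) * (r1 - r3)" "poly (pderiv W) r2 = (r2 - r1) * (r2 - r3)"
    "poly (pderiv W) r3 = (r3 - r1) * (r3 - r2)" "poly W r1 = 0" "poly W r2 = 0" "poly W r3 = 0"
    unfolding W_def by (auto simp: pderiv_mult pderiv_pCons algebra_simps)
  have F0: "poly F r1 = 0" "poly F r2 = 0" "poly F r3 = 0"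
    unfolding F_def using assms Wv by (auto simp: poly_trinomial)
  have dF: "poly (pderiv F) r = d r - (poly (pderiv W) r * poly Q r + poly W r * poly (pderiv Q) r)" for r
    unfolding F_def d_def by (simp add: pderiv_diff pderiv_mult algebra_simps)
  have F1: "poly (pderiv F) r1 = 0" "poly (pderiv F) r2 = 0" "poly (pderiv F) r3 = 0"
    unfolding dF Wv Qv e1_def e2_def e3_def using ne by simp_all
  \<comment> \<open>\<open>F'\<close> vanishes at the three nodes and, by Rolle, once in each gap: five zeros, then four, three, two.\<close>
  obtain x1 where x1: "r1 < x1" "x1 < r2" "poly (pderiv F) x1 = 0" using poly_Rolle[OF assms(3) F0(1,2)] .
  obtain x2 where x2: "r2 < x2" "x2 < r3" "poly (pderiv F) x2 = 0" using poly_Rolle[OF assms(4) F0(2,3)] .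
  obtain y1 where y1: "r1 < y1" "y1 < x1" "poly (pderiv (pderiv F)) y1 = 0"
    using poly_Rolle[OF x1(1) F1(1) x1(3)] .
  obtain y2 where y2: "x1 < y2" "y2 < r2" "poly (pderiv (pderiv F)) y2 = 0"
    using poly_Rolle[OF x1(2) x1(3) F1(2)] .
  obtain y3 where y3: "r2 < y3" "y3 < x2" "poly (pderiv (pderiv F)) y3 = 0"
    using poly_Rolle[OF x2(1) F1(2) x2(3)] .
  obtain y4 where y4: "x2 < y4" "y4 < r3" "poly (pderiv (pderiv F)) y4 = 0"
    using poly_Rolle[OF x2(2) x2(3) F1(3)] .
  have y: "y1 < y2" "y2 < y3" "y3 < y4" using y1 y2 y3 y4 by auto
  obtain z1 where z1: "y1 < z1" "z1 < y2" "poly (pderiv (pderiv (pderiv F))) z1 = 0"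
    using poly_Rolle[OF y(1) y1(3) y2(3)] .
  obtain z2 where z2: "y2 < z2" "z2 < y3" "poly (pderiv (pderiv (pderiv F))) z2 = 0"
    using poly_Rolle[OF y(2) y2(3) y3(3)] .
  obtain z3 where z3: "y3 < z3" "z3 < y4" "poly (pderiv (pderiv (pderiv F))) z3 = 0"
    using poly_Rolle[OF y(3) y3(3) y4(3)] .
  have z: "z1 < z2" "z2 < z3" using z1 z2 z3 by auto
  obtain a where a: "z1 < a" "a < z2" "poly (pderiv (pderiv (pderiv (pderiv F)))) a = 0"
    using poly_Rolle[OF z(1) z1(3) z2(3)] .
  obtain b where b: "z2 < b" "b < z3" "poly (pderiv (pderiv (pderiv (pderiv F)))) b = 0"
    using poly_Rolle[OF z(2) z2(3) z3(3)] .
  obtain h0 h1 h2 h3 h4 where WQ: "W * Q = [:h0, h1, h2, h3, h4, K:]"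
  proof -
    have "\<exists>h0 h1 h2 h3 h4. W * Q = [:h0, h1, h2, h3, h4, K:]"
      unfolding W_def Q_def by simp
    then show ?thesis using that by blast
  qed
  define C where "C = real p * (real (p - 1) * (real (p - 2) * real (p - 3)))"
  have F4: "poly (pderiv (pderiv (pderiv (pderiv F)))) x = C * x ^ (p - 4) - (24 * h4 + 120 * K * x)" for x
    unfolding F_def WQ trinomial_def C_def
    by (simp add: pderiv_diff pderiv_monom pderiv_pCons poly_monom numeral_eq_Suc diff_diff_left algebra_simps)
  \<comment> \<open>For \<open>p = 3\<close> the truncated exponent \<open>p - 4\<close> is harmless because the factor \<open>p - 3\<close> makes \<open>C\<close> vanish.\<close>
  have "C * a ^ (p - 4) \<le> C * b ^ (p - 4)"
  proof (cases "p = 3")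
    case False
    then have "odd (p - 4)" using assms(1,2) by presburger
    then show ?thesis
      unfolding C_def using a b by (intro mult_left_mono power_mono_odd) auto
  qed (simp add: C_def)
  moreover have "K * b < K * a" using K a b by simp
  ultimately show False using a(3) b(3) unfolding F4 by simp
qed

text \<open>The combinatorial core: a point whose coordinates are roots of one trinomial, and at which the
  second variation is negative on the tangent directions (those with \<open>\<Sum> y\<^sub>k = \<Sum> x\<^sub>k y\<^sub>k = 0\<close>), takes only two
  values, one of them once.\<close>

lemma one_exceptional_coordinate:
  fixes x :: "'a \<Rightarrow> real"
  assumes "finite I" "p \<ge> 2"
    and root: "\<And>k. k \<in> I \<Longrightarrow> x k ^ p = \<mu> * x k + c"
    and second: "\<And>y. (\<Sum>k\<in>I. y k) = 0 \<Longrightarrow> (\<Sum>k\<in>I. x k * y k) = 0 \<Longrightarrow> \<exists>k\<in>I. y k \<noteq> 0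
            \<Longrightarrow> (\<Sum>k\<in>I. (real p * x k ^ (p - 1) - \<mu>) * (y k)\<^sup>2) < 0"
    and nonconst: "i\<^sub>0 \<in> I" "j\<^sub>0 \<in> I" "x i\<^sub>0 \<noteq> x j\<^sub>0"
  obtains i b where "i \<in> I" "\<And>k. k \<in> I \<Longrightarrow> k \<noteq> i \<Longrightarrow> x k = b"
proof -
  have repeated: "real p * x i ^ (p - 1) < \<mu>" if "i \<in> I" "j \<in> I" "i \<noteq> j" "x i = x j" for i j
  proof -
    let ?y = "\<lambda>k. if k = i then 1 else if k = j then - 1 else 0 :: real"
    have s: "(\<Sum>k\<in>I. g k * ?y k) = g i - g j" "(\<Sum>k\<in>I. g k * (?y k)\<^sup>2) = g i + g j" for g
    proof -
      have "(\<Sum>k\<in>I. g k * ?y k) = (\<Sum>k\<in>I. (if k = i then g i else 0) - (if k = j then g j else 0))"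
        using that by (intro sum.cong) auto
      then show "(\<Sum>k\<in>I. g k * ?y k) = g i - g j"
        using that assms(1) by (simp add: sum_subtractf)
      have "(\<Sum>k\<in>I. g k * (?y k)\<^sup>2) = (\<Sum>k\<in>I. (if k = i then g i else 0) + (if k = j then g j else 0))"
        using that by (intro sum.cong) auto
      then show "(\<Sum>k\<in>I. g k * (?y k)\<^sup>2) = g i + g j"
        using that assms(1) by (simp add: sum.distrib)
    qed
    have "(\<Sum>k\<in>I. (real p * x k ^ (p - 1) - \<mu>) * (?y k)\<^sup>2) < 0"
      using s(1)[of "\<lambda>_. 1"] s(1)[of x] that by (intro second) auto
    then show ?thesis unfolding s using that by simp
  qed
  have no_three: False if "i \<in> I" "j \<in> I" "k \<in> I" "x i < x j" "x j < x k" for i j k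
  proof (cases "even p")
    case True
    then show False using trinomial_even_two_roots[OF True assms(2) that(4,5)] root that by blast
  next
    case False
    let ?y = "\<lambda>l. if l = i then x k - x j else if l = j then x i - x k else if l = k then x j - x i else 0"
    have dist: "i \<noteq> j" "j \<noteq> k" "i \<noteq> k" using that by auto
    have s: "(\<Sum>l\<in>I. g l * ?y l) = g i * (x k - x j) + g j * (x i - x k) + g k * (x j - x i)"
      "(\<Sum>l\<in>I. g l * (?y l)\<^sup>2) = g i * (x k - x j)\<^sup>2 + g j * (x i - x k)\<^sup>2 + g k * (x j - x i)\<^sup>2" for g
    proof -
      have "(\<Sum>l\<in>I. g l * ?y l) = (\<Sum>l\<in>{i, j, k}. g l * ?y l)"
        using that assms(1) by (intro sum.mono_neutral_right) auto
      then show "(\<Sum>l\<in>I. g l * ?y l) = g i * (x k - x j) + g j * (x i - x k) + g k * (x j - x i)"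
        using dist by (simp add: add.assoc)
      have "(\<Sum>l\<in>I. g l * (?y l)\<^sup>2) = (\<Sum>l\<in>{i, j, k}. g l * (?y l)\<^sup>2)"
        using that assms(1) by (intro sum.mono_neutral_right) auto
      then show "(\<Sum>l\<in>I. g l * (?y l)\<^sup>2) = g i * (x k - x j)\<^sup>2 + g j * (x i - x k)\<^sup>2 + g k * (x j - x i)\<^sup>2"
        using dist by (simp add: add.assoc)
    qed
    have "(\<Sum>l\<in>I. (real p * x l ^ (p - 1) - \<mu>) * (?y l)\<^sup>2) < 0"
    proof (rule second)
      show "sum ?y I = 0" using s(1)[of "\<lambda>_. 1"] by simp
      show "(\<Sum>l\<in>I. x l * ?y l) = 0" unfolding s by (simp add: algebra_simps)
      show "\<exists>l\<in>I. ?y l \<noteq> 0" using that by (intro bexI[of _ i]) auto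
    qed
    moreover have "p \<ge> 3" using False assms(2) by (cases "p = 2") auto
    ultimately show False
      using trinomial_weighted_slopes_nonneg[OF False _ that(4,5) root root root] that unfolding s by force
  qed
  obtain i j where ij: "i \<in> I" "j \<in> I" "x i < x j"
    using nonconst by (metis linorder_neqE_linordered_idom)
  have two: "x k = x i \<or> x k = x j" if "k \<in> I" for k
    using no_three[of k i j] no_three[of i k j] no_three[of i j k] that ij by force
  show ?thesis
  proof (cases "\<exists>k\<in>I. k \<noteq> i \<and> x k = x i")
    case False
    then show ?thesis using two ij by (intro that[of i "x j"]) auto
  next
    case True
    then have "real p * x i ^ (p - 1) < \<mu>" using repeated ij by metis
    then have "\<mu> \<le> real p * x j ^ (p - 1)"
      using trinomial_roots_not_both_descending[OF ij(3) root root] ij by fastforce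
    then have "\<not> (\<exists>k\<in>I. k \<noteq> j \<and> x k = x j)" using repeated[of j] ij by (metis not_le)
    then show ?thesis using two ij by (intro that[of j "x i"]) auto
  qed
qed

text \<open>Induction on \<open>p\<close> from the least admissible exponent, which is 4 for \<open>n = 2\<close>, 3 for \<open>n = 3\<close> and 2 otherwise.\<close>

lemma linear_less_power:
  fixes n p :: nat
  assumes "n \<ge> 2" "p \<ge> 2" "(n, p) \<notin> {(2, 2), (2, 3), (3, 2)}"
  shows "p * (n + 1) + 1 < n ^ p"
proof -
  have incr: "(p + 1) * (n + 1) + 1 < n ^ (p + 1)" if "p \<ge> 2" "n \<ge> 2" "p * (n + 1) + 1 < n ^ p" for n p :: nat
  proof -
    have "2 * (n + 1) \<le> p * (n + 1)" using that by (intro mult_right_mono) auto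
    then have "(p + 1) * (n + 1) + 1 \<le> 2 * (p * (n + 1) + 1)" by (simp add: algebra_simps)
    also have "\<dots> \<le> n * (p * (n + 1) + 1)" using that by (intro mult_right_mono) auto
    also have "\<dots> < n * n ^ p" using that by (intro mult_strict_left_mono) auto
    finally show ?thesis by simp
  qed
  have grow: "p * (n + 1) + 1 < n ^ p" if "p\<^sub>0 \<le> p" "p\<^sub>0 \<ge> 2" "n \<ge> 2" "p\<^sub>0 * (n + 1) + 1 < n ^ p\<^sub>0" for n p p\<^sub>0 :: nat
    using that(1)
  proof (induction p rule: dec_induct)
    case (step k)
    then show ?case using incr[of k n] that by simp
  qed (use that in simp)
  consider "n = 2" "p \<ge> 4" | "n = 3" "p \<ge> 3" | "n \<ge> 4" using assms by force
  then show ?thesis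
  proof cases
    case 1 then show ?thesis using grow[of 4 p 2] by simp
  next
    case 2 then show ?thesis using grow[of 3 p 3] by simp
  next
    case 3
    then have "2 * (n + 1) + 1 < 4 * n" by simp
    also have "4 * n \<le> n ^ 2" using 3 unfolding power2_eq_square by (intro mult_right_mono) auto
    finally show ?thesis using grow[of 2 p n] 3 assms by simp
  qed
qed

section \<open>Spectral radius and quadratic forms\<close>

lemma scalar_prod_sum: "a \<in> carrier_vec n \<Longrightarrow> b \<in> carrier_vec n \<Longrightarrow> a \<bullet> b = (\<Sum>j<n. a $ j * b $ j)"
  by (simp add: scalar_prod_def atLeast0LessThan)

lemma self_scalar_prod_nonneg: "(a :: real vec) \<bullet> a \<ge> 0"
  by (auto simp: scalar_prod_def intro!: sum_nonneg)

lemma self_scalar_prod_eq_0: "(a :: real vec) \<in> carrier_vec n \<Longrightarrow> a \<bullet> a = 0 \<longleftrightarrow> a = 0\<^sub>v n"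
  by (auto simp: scalar_prod_def sum_nonneg_eq_0_iff)

lemma orbit_bounded_if_spectral_radius_less_1:
  fixes A :: "real mat"
  assumes A: "A \<in> carrier_mat n n"
    and sr: "spectral_radius (map_mat complex_of_real A) < 1"
    and u: "u \<in> carrier_vec n"
  obtains C where "\<And>k. (A ^\<^sub>m k *\<^sub>v u) \<bullet> (A ^\<^sub>m k *\<^sub>v u) \<le> C"
proof -
  interpret of_real_hom: semiring_hom complex_of_real by standard auto
  have Ac: "map_mat complex_of_real A \<in> carrier_mat n n" using A by simp
  obtain c where c: "\<And>k. norm_bound (map_mat complex_of_real A ^\<^sub>m k) c"
    using spectral_radius_jnf_norm_bound_less_1_upper_triangular[OF Ac sr] by blast
  have ent: "\<bar>(A ^\<^sub>m k) $$ (i, j)\<bar> \<le> c" if "i < n" "j < n" for i j k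
  proof -
    have "map_mat complex_of_real A ^\<^sub>m k = map_mat complex_of_real (A ^\<^sub>m k)"
      using of_real_hom.mat_hom_pow[OF A] by (rule sym)
    then have "norm_bound (map_mat complex_of_real (A ^\<^sub>m k)) c" using c[of k] by simp
    then have "norm (map_mat complex_of_real (A ^\<^sub>m k) $$ (i, j)) \<le> c"
      using that A unfolding norm_bound_def by (auto simp: pow_mat_dim_square[OF A])
    then show ?thesis using that A by (simp add: pow_mat_dim_square[OF A])
  qed
  define D where "D = (\<Sum>j<n. c * \<bar>u $ j\<bar>)"
  have coord: "\<bar>(A ^\<^sub>m k *\<^sub>v u) $ i\<bar> \<le> D" if "i < n" for i k
  proof -
    have "(A ^\<^sub>m k *\<^sub>v u) $ i = (\<Sum>j<n. (A ^\<^sub>m k) $$ (i, j) * u $ j)"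
      using that A u by (simp add: scalar_prod_def pow_mat_dim_square[OF A] atLeast0LessThan)
    then have "\<bar>(A ^\<^sub>m k *\<^sub>v u) $ i\<bar> \<le> (\<Sum>j<n. \<bar>(A ^\<^sub>m k) $$ (i, j) * u $ j\<bar>)" by simp
    also have "\<dots> \<le> D"
      unfolding D_def using that ent by (intro sum_mono) (auto simp: abs_mult intro!: mult_right_mono)
    finally show ?thesis .
  qed
  show ?thesis
  proof (rule that)
    fix k
    have "(A ^\<^sub>m k *\<^sub>v u) \<bullet> (A ^\<^sub>m k *\<^sub>v u) = (\<Sum>i<n. (A ^\<^sub>m k *\<^sub>v u) $ i * (A ^\<^sub>m k *\<^sub>v u) $ i)"
      using A u by (intro scalar_prod_sum) (auto intro!: carrier_vecI simp: pow_mat_dim_square[OF A])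
    also have "\<dots> \<le> (\<Sum>i<n. D\<^sup>2)"
    proof (rule sum_mono)
      fix i assume "i \<in> {..<n}"
      then have "\<bar>(A ^\<^sub>m k *\<^sub>v u) $ i\<bar>\<^sup>2 \<le> D\<^sup>2" using coord by (intro power_mono) auto
      then show "(A ^\<^sub>m k *\<^sub>v u) $ i * (A ^\<^sub>m k *\<^sub>v u) $ i \<le> D\<^sup>2" by (simp add: power2_eq_square)
    qed
    finally show "(A ^\<^sub>m k *\<^sub>v u) \<bullet> (A ^\<^sub>m k *\<^sub>v u) \<le> (\<Sum>i<n. D\<^sup>2)" .
  qed
qed

text \<open>Along the orbit \<open>s\<^sub>k = A\<^sup>k u\<close> the squared norms \<open>a\<^sub>k\<close> form a convex sequence, because
  \<open>a\<^sub>k\<^sub>+\<^sub>1 = s\<^sub>k \<bullet> s\<^sub>k\<^sub>+\<^sub>2\<close> by symmetry. The sequence is bounded since the spectral radius is less than 1, so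
  \<open>a\<^sub>1 \<le> a\<^sub>0\<close>. If the claim failed, \<open>(A u - u) \<bullet> (A u - u) \<le> a\<^sub>1 - a\<^sub>0 \<le> 0\<close> would make \<open>u\<close> an eigenvector for
  the eigenvalue 1.\<close>

lemma symmetric_quadratic_form_less:
  fixes A :: "real mat"
  assumes A: "A \<in> carrier_mat n n"
    and sym: "\<And>i j. i < n \<Longrightarrow> j < n \<Longrightarrow> A $$ (i, j) = A $$ (j, i)"
    and sr: "spectral_radius (map_mat complex_of_real A) < 1"
    and u: "u \<in> carrier_vec n" "u \<noteq> 0\<^sub>v n"
  shows "u \<bullet> (A *\<^sub>v u) < u \<bullet> u"
proof (rule ccontr)
  assume not: "\<not> u \<bullet> (A *\<^sub>v u) < u \<bullet> u"
  interpret of_real_hom: semiring_hom complex_of_real by standard auto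
  have "A = A\<^sup>T" using A sym by (intro eq_matI) auto
  then have swap: "x \<bullet> (A *\<^sub>v y) = (A *\<^sub>v x) \<bullet> y" if "x \<in> carrier_vec n" "y \<in> carrier_vec n" for x y
    using that A by (metis transpose_vec_mult_scalar comm_scalar_prod mult_mat_vec_carrier)
  define s where "s k = A ^\<^sub>m k *\<^sub>v u" for k
  define a where "a k = s k \<bullet> s k" for k
  have Ak: "A ^\<^sub>m k \<in> carrier_mat n n" for k using A by simp
  have sc: "s k \<in> carrier_vec n" for k unfolding s_def by (rule mult_mat_vec_carrier[OF Ak u(1)])
  have s0: "s 0 = u" unfolding s_def using A u by simp
  have pow_Suc: "A ^\<^sub>m Suc k = A * A ^\<^sub>m k" for k
    using A by (induction k) (auto simp: assoc_mult_mat[OF A _ A] intro: assoc_mult_mat)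
  have sSuc: "s (Suc k) = A *\<^sub>v s k" for k
    unfolding s_def pow_Suc using A Ak u by (intro assoc_mult_mat_vec) auto
  have diff_sq: "(x - y) \<bullet> (x - y) = x \<bullet> x - 2 * (y \<bullet> x) + y \<bullet> y"
    if "x \<in> carrier_vec n" "y \<in> carrier_vec n" for x y :: "real vec"
    using that by (simp add: scalar_prod_sum[of _ n] sum.distrib sum_subtractf sum_distrib_left algebra_simps)
  have convex: "2 * a (Suc k) \<le> a k + a (Suc (Suc k))" for k
  proof -
    have "s k \<bullet> s (Suc (Suc k)) = a (Suc k)"
      unfolding a_def sSuc[of "Suc k"] using swap[OF sc sc, of k "Suc k"] by (simp add: sSuc)
    moreover have "0 \<le> (s (Suc (Suc k)) - s k) \<bullet> (s (Suc (Suc k)) - s k)"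
      by (rule self_scalar_prod_nonneg)
    ultimately show ?thesis using diff_sq[OF sc sc, of "Suc (Suc k)" k] by (simp add: a_def)
  qed
  define \<delta> where "\<delta> = a 1 - a 0"
  have step: "a (Suc k) - a k \<ge> \<delta>" for k
  proof (induction k)
    case (Suc k) then show ?case using convex[of k] by simp
  qed (simp add: \<delta>_def)
  have linear: "a k \<ge> a 0 + real k * \<delta>" for k
  proof (induction k)
    case (Suc k) then show ?case using step[of k] by (simp add: algebra_simps)
  qed simp
  obtain C where C: "\<And>k. a k \<le> C"
    using orbit_bounded_if_spectral_radius_less_1[OF A sr u(1)] unfolding a_def s_def by blast
  have "\<delta> \<le> 0"
  proof (rule ccontr)
    assume "\<not> \<delta> \<le> 0"
    then obtain k where "C - a 0 < real k * \<delta>" using reals_Archimedean3[of \<delta>] by auto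
    then show False using linear[of k] C[of k] by simp
  qed
  moreover have "(A *\<^sub>v u - u) \<bullet> (A *\<^sub>v u - u) \<le> \<delta>"
    using diff_sq[OF sc sc, of 1 0] not sSuc[of 0] unfolding \<delta>_def a_def by (simp add: s0)
  ultimately have "(A *\<^sub>v u - u) \<bullet> (A *\<^sub>v u - u) = 0"
    using self_scalar_prod_nonneg[of "A *\<^sub>v u - u"] by linarith
  then have z: "A *\<^sub>v u - u = 0\<^sub>v n"
    using A u self_scalar_prod_eq_0[of "A *\<^sub>v u - u" n] by (metis minus_carrier_vec mult_mat_vec_carrier)
  have fixed: "A *\<^sub>v u = u"
  proof (rule eq_vecI)
    show "(A *\<^sub>v u) $ i = u $ i" if "i < dim_vec u" for i
      using arg_cong[OF z, of "\<lambda>v. v $ i"] that A u by simp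
  qed (use A u in auto)
  let ?u = "map_vec complex_of_real u"
  have n: "n > 0" using u by (cases n) auto
  have "map_mat complex_of_real A *\<^sub>v ?u = 1 \<cdot>\<^sub>v ?u"
    using of_real_hom.mult_mat_vec_hom[OF A u(1)] unfolding fixed by (metis one_smult_vec)
  moreover have "?u \<noteq> 0\<^sub>v n" using u by (auto simp: vec_eq_iff)
  ultimately have "1 \<in> spectrum (map_mat complex_of_real A)"
    using A u unfolding spectrum_def eigenvalue_def eigenvector_def by (auto intro!: exI[of _ ?u])
  then have "1 \<le> spectral_radius (map_mat complex_of_real A)"
    using A n by (intro spectral_radius_mem_max(2)[of _ n]) force+
  then show False using sr by simp
qed

lemma spectral_radius_scaled_projection_le:
  fixes w :: "real vec"
  assumes n: "n > 0" and w: "w \<in> carrier_vec n" "w \<bullet> w = 1"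
  shows "spectral_radius (map_mat complex_of_real (\<kappa> \<cdot>\<^sub>m (1\<^sub>m n - outer n w))) \<le> \<bar>\<kappa>\<bar>"
proof -
  let ?B = "map_mat complex_of_real (\<kappa> \<cdot>\<^sub>m (1\<^sub>m n - outer n w))"
  have B: "?B \<in> carrier_mat n n" by (auto simp: outer_def)
  obtain z where z: "z \<in> spectrum ?B" "spectral_radius ?B = norm z"
    using spectral_radius_mem_max(1)[OF B n] by auto
  obtain u where u: "u \<in> carrier_vec n" "u \<noteq> 0\<^sub>v n" "?B *\<^sub>v u = z \<cdot>\<^sub>v u"
    using z B unfolding spectrum_def eigenvalue_def eigenvector_def by auto
  define W where "W i = complex_of_real (w $ i)" for i
  define t where "t = (\<Sum>i<n. W i * u $ i)"
  have W1: "(\<Sum>i<n. W i * W i) = 1"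
    using w unfolding W_def by (simp add: scalar_prod_sum[of _ n] flip: of_real_mult of_real_sum)
  have eq: "\<kappa> * (u $ i - W i * t) = z * u $ i" if i: "i < n" for i
  proof -
    have "z * u $ i = (?B *\<^sub>v u) $ i" using u i by simp
    also have "\<dots> = (\<Sum>j<n. \<kappa> * ((if i = j then u $ j else 0) - W i * (W j * u $ j)))"
      using i u(1) by (auto simp: scalar_prod_def outer_def W_def atLeast0LessThan algebra_simps intro!: sum.cong)
    also have "\<dots> = \<kappa> * (u $ i - W i * t)"
      using i by (simp add: t_def sum_subtractf flip: sum_distrib_left)
    finally show ?thesis ..
  qed
  have "z * t = (\<Sum>i<n. W i * (\<kappa> * (u $ i - W i * t)))"
    using eq by (subst t_def) (auto simp: sum_distrib_left mult.left_commute[of z] intro!: sum.cong)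
  also have "\<dots> = \<kappa> * ((\<Sum>i<n. W i * u $ i) - (\<Sum>i<n. W i * W i) * t)"
    by (simp add: sum_distrib_left sum_distrib_right sum_subtractf algebra_simps)
  also have "\<dots> = 0" unfolding W1 by (simp add: t_def)
  finally have "z = 0 \<or> t = 0" by simp
  then have "norm z \<le> \<bar>\<kappa>\<bar>"
  proof
    assume "t = 0"
    obtain i where "i < n" "u $ i \<noteq> 0" using u by (auto simp: vec_eq_iff)
    then have "z = \<kappa>" using eq[of i] \<open>t = 0\<close> by simp
    then show ?thesis by simp
  qed simp
  then show ?thesis using z by simp
qed

section \<open>Coordinates with respect to a regular simplex frame\<close>

lemma sum_index_lists_prod:
  "(\<Sum>is \<in> index_lists n k. (\<Prod>j\<leftarrow>is. a $ j) * (\<Prod>j\<leftarrow>is. b $ j)) = ((\<Sum>j<n. a $ j * b $ j) :: real) ^ k"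
proof (induction k)
  case 0
  have "index_lists n 0 = {[]}" by (auto simp: index_lists_def)
  then show ?case by simp
next
  case (Suc k)
  let ?t = "\<lambda>is. (\<Prod>j\<leftarrow>is. a $ j) * (\<Prod>j\<leftarrow>is. b $ j)"
  have "index_lists n (Suc k) = (\<lambda>(j, is). j # is) ` ({..<n} \<times> index_lists n k)"
    by (auto simp: index_lists_def length_Suc_conv image_iff)
  moreover have "inj_on (\<lambda>(j, is). j # is) ({..<n} \<times> index_lists n k)"
    by (auto simp: inj_on_def)
  ultimately have "sum ?t (index_lists n (Suc k)) = (\<Sum>(j, is) \<in> {..<n} \<times> index_lists n k. ?t (j # is))"
    by (simp add: sum.reindex case_prod_unfold)
  also have "\<dots> = (\<Sum>j<n. \<Sum>is \<in> index_lists n k. a $ j * b $ j * ?t is)"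
    by (simp add: sum.cartesian_product mult_ac)
  also have "\<dots> = (\<Sum>j<n. a $ j * b $ j) * sum ?t (index_lists n k)"
    by (simp add: sum_product)
  finally show ?case using Suc by simp
qed

locale regular_simplex =
  fixes n :: nat and w :: "nat \<Rightarrow> real vec"
  assumes n2: "n \<ge> 2" and frame: "simplex_frame n w"
begin

lemma w_carrier: "i \<in> {1..n+1} \<Longrightarrow> w i \<in> carrier_vec n"
  and w_unit: "i \<in> {1..n+1} \<Longrightarrow> w i \<bullet> w i = 1"
  and w_angle: "i \<in> {1..n+1} \<Longrightarrow> j \<in> {1..n+1} \<Longrightarrow> i \<noteq> j \<Longrightarrow> w i \<bullet> w j = - 1 / real n"
  using frame unfolding simplex_frame_def by auto

lemma resolution:
  assumes "r < n" "c < n"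
  shows "(\<Sum>i=1..n+1. w i $ r * w i $ c) = (if r = c then (real n + 1) / real n else 0)"
proof -
  have "mat n n (\<lambda>(r, c). \<Sum>i=1..n+1. outer n (w i) $$ (r, c)) $$ (r, c)
      = (((real n + 1) / real n) \<cdot>\<^sub>m 1\<^sub>m n) $$ (r, c)"
    using frame unfolding simplex_frame_def by metis
  then show ?thesis using assms by (simp add: outer_def split: if_splits)
qed

lemma reconstruction:
  assumes "v \<in> carrier_vec n" "r < n"
  shows "(\<Sum>i=1..n+1. (w i \<bullet> v) * w i $ r) = (real n + 1) / real n * v $ r"
proof -
  have "(\<Sum>i=1..n+1. (w i \<bullet> v) * w i $ r) = (\<Sum>i=1..n+1. \<Sum>c<n. v $ c * (w i $ r * w i $ c))"
    using assms w_carrier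
    by (intro sum.cong) (auto simp: scalar_prod_sum[of _ n] sum_distrib_right sum_distrib_left mult_ac)
  also have "\<dots> = (\<Sum>c<n. v $ c * (\<Sum>i=1..n+1. w i $ r * w i $ c))"
    by (subst sum.swap) (simp only: sum_distrib_left)
  also have "\<dots> = (\<Sum>c<n. v $ c * (if r = c then (real n + 1) / real n else 0))"
    using assms by (intro sum.cong refl) (simp only: resolution lessThan_iff)
  also have "\<dots> = (real n + 1) / real n * v $ r"
    using assms by (simp add: if_distrib[of "\<lambda>x. _ * x"] cong: if_cong)
  finally show ?thesis .
qed

lemma parseval:
  assumes "u \<in> carrier_vec n" "v \<in> carrier_vec n"
  shows "(\<Sum>i=1..n+1. (w i \<bullet> u) * (w i \<bullet> v)) = (real n + 1) / real n * (u \<bullet> v)"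
proof -
  have "(\<Sum>i=1..n+1. (w i \<bullet> u) * (w i \<bullet> v)) = (\<Sum>i=1..n+1. \<Sum>r<n. v $ r * ((w i \<bullet> u) * w i $ r))"
    using assms w_carrier
    by (intro sum.cong refl) (auto simp: scalar_prod_sum[of "w _" n v] sum_distrib_left mult_ac)
  also have "\<dots> = (\<Sum>r<n. v $ r * (\<Sum>i=1..n+1. (w i \<bullet> u) * w i $ r))"
    by (subst sum.swap) (simp only: sum_distrib_left)
  also have "\<dots> = (\<Sum>r<n. v $ r * ((real n + 1) / real n * u $ r))"
    using assms by (intro sum.cong refl) (simp only: reconstruction lessThan_iff)
  also have "\<dots> = (real n + 1) / real n * (u \<bullet> v)"
    using assms by (simp add: scalar_prod_sum[of _ n] sum_distrib_left mult_ac)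
  finally show ?thesis .
qed

text \<open>Synthesis followed by analysis: on coefficient vectors with sum zero the Gram matrix of the frame is the
  scalar \<open>(n + 1) / n\<close>. So every such vector is, up to this scalar, the coordinate vector of a point of the space.\<close>

lemma gram_sum:
  assumes k: "k \<in> {1..n+1}"
  shows "(\<Sum>i=1..n+1. y i * (w k \<bullet> w i)) = (real n + 1) / real n * y k - (\<Sum>i=1..n+1. y i) / real n"
proof -
  have "(\<Sum>i=1..n+1. y i * (w k \<bullet> w i))
      = (\<Sum>i=1..n+1. (if i = k then (real n + 1) / real n * y i else 0) - y i / real n)"
    using k n2 by (intro sum.cong refl) (auto simp: w_unit w_angle field_simps)
  then show ?thesis using k by (simp add: sum_subtractf sum_divide_distrib del: sum.cl_ivl_Suc)
qed

lemma angle_power_sum: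
  assumes k: "k \<in> {1..n+1}"
  shows "(\<Sum>i=1..n+1. (w i \<bullet> w k) ^ e * g i)
    = (1 - (- 1 / real n) ^ e) * g k + (- 1 / real n) ^ e * (\<Sum>i=1..n+1. g i)"
proof -
  have "(\<Sum>i=1..n+1. (w i \<bullet> w k) ^ e * g i)
      = (\<Sum>i=1..n+1. (if i = k then (1 - (- 1 / real n) ^ e) * g k else 0) + (- 1 / real n) ^ e * g i)"
    using k by (intro sum.cong refl) (auto simp: w_unit w_angle algebra_simps)
  then show ?thesis using k by (simp add: sum.distrib sum_distrib_left del: sum.cl_ivl_Suc)
qed

text \<open>Reconstructing \<open>w\<^sub>1\<close> from its known coordinates \<open>1, -1/n, \<dots>, -1/n\<close> leaves \<open>\<Sum> w\<^sub>i\<close> as the only error term.\<close>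

lemma frame_sum_zero:
  assumes "r < n"
  shows "(\<Sum>i=1..n+1. w i $ r) = 0"
proof -
  have 1: "1 \<in> {1..n+1}" by simp
  have "(real n + 1) / real n * w 1 $ r
      = (1 + 1 / real n) * w 1 $ r - (\<Sum>i=1..n+1. w i $ r) / real n"
    using angle_power_sum[OF 1, of 1 "\<lambda>i. w i $ r"] reconstruction[OF w_carrier[OF 1] assms]
    by (simp del: sum.cl_ivl_Suc)
  then show ?thesis using n2 by (simp add: add_divide_distrib del: sum.cl_ivl_Suc)
qed

lemma coordinate_sum_zero:
  assumes "v \<in> carrier_vec n"
  shows "(\<Sum>i=1..n+1. w i \<bullet> v) = 0"
proof -
  have "(\<Sum>i=1..n+1. w i \<bullet> v) = (\<Sum>i=1..n+1. \<Sum>r<n. v $ r * w i $ r)"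
    using assms w_carrier by (intro sum.cong refl) (auto simp: scalar_prod_sum[of _ n] mult_ac)
  also have "\<dots> = (\<Sum>r<n. v $ r * (\<Sum>i=1..n+1. w i $ r))"
    by (subst sum.swap) (simp only: sum_distrib_left)
  also have "\<dots> = 0"
    by (intro sum.neutral ballI) (simp only: frame_sum_zero lessThan_iff mult_zero_right)
  finally show ?thesis .
qed

lemma combination_scalar_prod:
  assumes "v \<in> carrier_vec n"
  shows "v \<bullet> vec n (\<lambda>r. \<Sum>i=1..n+1. y i * w i $ r) = (\<Sum>i=1..n+1. y i * (v \<bullet> w i))"
proof -
  have "v \<bullet> vec n (\<lambda>r. \<Sum>i=1..n+1. y i * w i $ r) = (\<Sum>r<n. \<Sum>i=1..n+1. y i * (v $ r * w i $ r))"
    using assms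
    by (simp add: scalar_prod_sum[of _ n] sum_distrib_left mult_ac del: sum.cl_ivl_Suc)
  also have "\<dots> = (\<Sum>i=1..n+1. y i * (\<Sum>r<n. v $ r * w i $ r))"
    by (subst sum.swap) (simp only: sum_distrib_left)
  also have "\<dots> = (\<Sum>i=1..n+1. y i * (v \<bullet> w i))"
    using assms w_carrier by (intro sum.cong refl) (simp add: scalar_prod_sum[of _ n])
  finally show ?thesis .
qed

lemma tensor_contraction:
  assumes "v \<in> carrier_vec n"
  shows "(\<Sum>is \<in> index_lists n k. (\<Sum>i=1..n+1. g i * (\<Prod>j\<leftarrow>is. w i $ j)) * (\<Prod>j\<leftarrow>is. v $ j))
    = (\<Sum>i=1..n+1. g i * (w i \<bullet> v) ^ k)"
proof -
  have "(\<Sum>is \<in> index_lists n k. (\<Sum>i=1..n+1. g i * (\<Prod>j\<leftarrow>is. w i $ j)) * (\<Prod>j\<leftarrow>is. v $ j))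
      = (\<Sum>is \<in> index_lists n k. \<Sum>i=1..n+1. g i * ((\<Prod>j\<leftarrow>is. w i $ j) * (\<Prod>j\<leftarrow>is. v $ j)))"
    by (simp only: sum_distrib_right mult.assoc)
  also have "\<dots> = (\<Sum>i=1..n+1. g i * (\<Sum>is \<in> index_lists n k. (\<Prod>j\<leftarrow>is. w i $ j) * (\<Prod>j\<leftarrow>is. v $ j)))"
    by (subst sum.swap) (simp only: sum_distrib_left)
  also have "\<dots> = (\<Sum>i=1..n+1. g i * (w i \<bullet> v) ^ k)"
    using assms w_carrier by (intro sum.cong refl) (simp add: scalar_prod_sum[of _ n] sum_index_lists_prod)
  finally show ?thesis .
qed

lemma simplex_tensor_vec:
  assumes "v \<in> carrier_vec n"
  shows "tensor_vec n m (simplex_tensor n w) v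
    = vec n (\<lambda>r. \<Sum>i=1..n+1. (w i \<bullet> v) ^ (m - 1) * w i $ r)"
proof -
  have "(\<Sum>is \<in> index_lists n (m - 1). simplex_tensor n w (r # is) * (\<Prod>k\<leftarrow>is. v $ k))
      = (\<Sum>i=1..n+1. (w i \<bullet> v) ^ (m - 1) * w i $ r)" for r
    using tensor_contraction[OF assms, where g = "\<lambda>i. w i $ r" and k = "m - 1"]
    unfolding simplex_tensor_def rank_one_tensor_def list.map prod_list.Cons
    by (simp only: mult.commute[of "w _ $ _" "(_ \<bullet> _) ^ _"])
  then show ?thesis by (simp only: tensor_vec_def)
qed

lemma simplex_tensor_mat:
  assumes "v \<in> carrier_vec n"
  shows "tensor_mat n m (simplex_tensor n w) v
    = mat n n (\<lambda>(r, c). \<Sum>i=1..n+1. (w i \<bullet> v) ^ (m - 2) * (w i $ r * w i $ c))"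
proof -
  have "(\<Sum>is \<in> index_lists n (m - 2). simplex_tensor n w (r # c # is) * (\<Prod>k\<leftarrow>is. v $ k))
      = (\<Sum>i=1..n+1. (w i \<bullet> v) ^ (m - 2) * (w i $ r * w i $ c))" for r c
    using tensor_contraction[OF assms, where g = "\<lambda>i. w i $ r * w i $ c" and k = "m - 2"]
    unfolding simplex_tensor_def rank_one_tensor_def list.map prod_list.Cons
    by (simp only: mult_ac)
  then show ?thesis by (simp only: tensor_mat_def)
qed

text \<open>Taking the scalar product of the eigenvector equation with \<open>w\<^sub>k\<close> decouples it: the other coordinates
  enter only through a constant that is the same for all \<open>k\<close>.\<close>

lemma eigenpair_coordinates:
  assumes "eigenpair n m (simplex_tensor n w) l v" "k \<in> {1..n+1}"
  shows "(w k \<bullet> v) ^ (m - 1) = real n * l / (real n + 1) * (w k \<bullet> v)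
    + (\<Sum>i=1..n+1. (w i \<bullet> v) ^ (m - 1)) / (real n + 1)"
proof -
  let ?P = "\<Sum>i=1..n+1. (w i \<bullet> v) ^ (m - 1)"
  have v: "v \<in> carrier_vec n" using assms by (simp add: eigenpair_def)
  have "l * (w k \<bullet> v) = w k \<bullet> tensor_vec n m (simplex_tensor n w) v"
    using assms v w_carrier[OF assms(2)] by (simp add: eigenpair_def)
  also have "\<dots> = (real n + 1) / real n * (w k \<bullet> v) ^ (m - 1) - ?P / real n"
    unfolding simplex_tensor_vec[OF v] combination_scalar_prod[OF w_carrier[OF assms(2)]]
    by (rule gram_sum[OF assms(2)])
  finally show ?thesis
    using n2 by (simp add: divide_simps del: sum.cl_ivl_Suc) (simp add: algebra_simps del: sum.cl_ivl_Suc)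
qed

lemma jacobian_carrier: "power_jacobian n m S l v \<in> carrier_mat n n"
  by (auto simp: power_jacobian_def outer_def)

lemma jacobian_entry:
  assumes "v \<in> carrier_vec n" "r < n" "c < n"
  shows "power_jacobian n m (simplex_tensor n w) l v $$ (r, c)
    = (real m - 1) / l * ((\<Sum>i=1..n+1. (w i \<bullet> v) ^ (m - 2) * (w i $ r * w i $ c)) - l * (v $ r * v $ c))"
  using assms unfolding power_jacobian_def simplex_tensor_mat[OF assms(1)] outer_def
  by (simp del: sum.cl_ivl_Suc)

lemma jacobian_quadratic_form:
  assumes v: "v \<in> carrier_vec n" and u: "u \<in> carrier_vec n" and orth: "v \<bullet> u = 0"
  shows "u \<bullet> (power_jacobian n m (simplex_tensor n w) l v *\<^sub>v u)
    = (real m - 1) / l * (\<Sum>i=1..n+1. (w i \<bullet> v) ^ (m - 2) * (w i \<bullet> u)\<^sup>2)"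
proof -
  let ?J = "power_jacobian n m (simplex_tensor n w) l v"
  let ?c = "(real m - 1) / l" and ?x = "\<lambda>i. (w i \<bullet> v) ^ (m - 2)"
  have sq: "(\<Sum>r<n. \<Sum>c<n. u $ r * (a $ r * a $ c) * u $ c) = (a \<bullet> u)\<^sup>2" if "a \<in> carrier_vec n" for a
    using that u by (simp add: scalar_prod_sum[of _ n] power2_eq_square sum_product mult_ac)
  have "u \<bullet> (?J *\<^sub>v u) = (\<Sum>r<n. u $ r * (\<Sum>c<n. ?J $$ (r, c) * u $ c))"
    using u jacobian_carrier[of m "simplex_tensor n w" l v]
    by (auto simp: scalar_prod_def atLeast0LessThan)
  also have "\<dots> = (\<Sum>r<n. \<Sum>c<n. ?c * ((\<Sum>i=1..n+1. ?x i * (u $ r * (w i $ r * w i $ c) * u $ c))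
      - l * (u $ r * (v $ r * v $ c) * u $ c)))"
    unfolding sum_distrib_left
  proof (intro sum.cong refl)
    fix r c assume "r \<in> {..<n}" "c \<in> {..<n}"
    then have rc: "r < n" "c < n" by auto
    show "u $ r * (?J $$ (r, c) * u $ c) = ?c * ((\<Sum>i=1..n+1. ?x i * (u $ r * (w i $ r * w i $ c) * u $ c))
      - l * (u $ r * (v $ r * v $ c) * u $ c))"
      unfolding jacobian_entry[OF v rc]
      by (simp add: sum_distrib_left sum_distrib_right algebra_simps del: sum.cl_ivl_Suc)
  qed
  also have "\<dots> = ?c * ((\<Sum>r<n. \<Sum>c<n. \<Sum>i=1..n+1. ?x i * (u $ r * (w i $ r * w i $ c) * u $ c))
      - l * (\<Sum>r<n. \<Sum>c<n. u $ r * (v $ r * v $ c) * u $ c))"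
    by (simp only: sum_distrib_left[symmetric] sum_subtractf)
  also have "(\<Sum>r<n. \<Sum>c<n. \<Sum>i=1..n+1. ?x i * (u $ r * (w i $ r * w i $ c) * u $ c))
     = (\<Sum>i=1..n+1. \<Sum>r<n. \<Sum>c<n. ?x i * (u $ r * (w i $ r * w i $ c) * u $ c))"
    by (subst sum.swap[of _ "{1..n+1}"], subst sum.swap[of _ "{1..n+1}"]) (rule refl)
  also have "\<dots> = (\<Sum>i=1..n+1. ?x i * (w i \<bullet> u)\<^sup>2)"
    using w_carrier by (intro sum.cong refl) (simp only: sum_distrib_left[symmetric] sq)
  also have "(\<Sum>r<n. \<Sum>c<n. u $ r * (v $ r * v $ c) * u $ c) = 0" using sq[OF v] orth by simp
  finally show ?thesis by simp
qed

section \<open>Robust eigenvectors and frame vectors\<close>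

text \<open>The test vector is \<open>u = \<Sum> y\<^sub>i w\<^sub>i\<close>, with coordinates \<open>(n + 1) / n \<cdot> y\<^sub>i\<close>; the second condition on
  \<open>y\<close> makes it orthogonal to \<open>v\<close>, where the rank-one part of the Jacobian drops out.\<close>

lemma robust_second_order:
  assumes m: "m \<ge> 3" and pair: "eigenpair n m (simplex_tensor n w) l v" and l: "l > 0"
    and sr: "spectral_radius (map_mat complex_of_real (power_jacobian n m (simplex_tensor n w) l v)) < 1"
    and y: "(\<Sum>i=1..n+1. y i) = 0" "(\<Sum>i=1..n+1. (w i \<bullet> v) * y i) = 0" "\<exists>i\<in>{1..n+1}. y i \<noteq> 0"
  shows "(\<Sum>i=1..n+1. (real (m - 1) * (w i \<bullet> v) ^ (m - 1 - 1) - real n * l / (real n + 1)) * (y i)\<^sup>2) < 0"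
proof -
  let ?S = "simplex_tensor n w"
  define N where "N = (real n + 1) / real n"
  have N: "N > 0" using n2 by (simp add: N_def)
  have v: "v \<in> carrier_vec n" using pair by (simp add: eigenpair_def)
  define u where "u = vec n (\<lambda>r. \<Sum>i=1..n+1. y i * w i $ r)"
  have u: "u \<in> carrier_vec n" by (simp add: u_def)
  have coord: "w k \<bullet> u = N * y k" if "k \<in> {1..n+1}" for k
    unfolding u_def combination_scalar_prod[OF w_carrier[OF that]] gram_sum[OF that] y(1) N_def by simp
  have "v \<bullet> u = (\<Sum>i=1..n+1. (w i \<bullet> v) * y i)"
    unfolding u_def combination_scalar_prod[OF v]
    using comm_scalar_prod[OF v w_carrier] by (intro sum.cong refl) (simp add: mult.commute)
  then have orth: "v \<bullet> u = 0" using y(2) by simp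
  have nz: "u \<noteq> 0\<^sub>v n"
  proof
    assume "u = 0\<^sub>v n"
    moreover obtain i where "i \<in> {1..n+1}" "y i \<noteq> 0" using y(3) by blast
    ultimately show False using coord[of i] w_carrier[of i] N by simp
  qed
  have "(real m - 1) / l * (\<Sum>i=1..n+1. (w i \<bullet> v) ^ (m - 2) * (w i \<bullet> u)\<^sup>2) < u \<bullet> u"
    unfolding jacobian_quadratic_form[OF v u orth, symmetric]
  proof (rule symmetric_quadratic_form_less[OF jacobian_carrier _ sr u nz])
    fix r c assume "r < n" "c < n"
    then show "power_jacobian n m ?S l v $$ (r, c) = power_jacobian n m ?S l v $$ (c, r)"
      by (simp only: jacobian_entry[OF v] mult.commute[of "_ $ r" "_ $ c"])
  qed
  moreover have "(\<Sum>i=1..n+1. (w i \<bullet> v) ^ (m - 2) * (w i \<bullet> u)\<^sup>2)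
      = N\<^sup>2 * (\<Sum>i=1..n+1. (w i \<bullet> v) ^ (m - 2) * (y i)\<^sup>2)"
    unfolding sum_distrib_left by (intro sum.cong refl) (simp add: coord power_mult_distrib)
  moreover have "u \<bullet> u = N * (\<Sum>i=1..n+1. (y i)\<^sup>2)"
  proof -
    have "N * (u \<bullet> u) = (\<Sum>i=1..n+1. (w i \<bullet> u) * (w i \<bullet> u))"
      unfolding N_def by (rule parseval[OF u u, symmetric])
    also have "\<dots> = N * (N * (\<Sum>i=1..n+1. (y i)\<^sup>2))"
      unfolding sum_distrib_left by (intro sum.cong refl) (simp add: coord power2_eq_square)
    finally show ?thesis using N by simp
  qed
  ultimately have "N * ((real m - 1) / l * N * (\<Sum>i=1..n+1. (w i \<bullet> v) ^ (m - 2) * (y i)\<^sup>2))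
      < N * (\<Sum>i=1..n+1. (y i)\<^sup>2)"
    by (simp only: power2_eq_square mult_ac)
  then have "(real m - 1) / l * N * (\<Sum>i=1..n+1. (w i \<bullet> v) ^ (m - 2) * (y i)\<^sup>2) < (\<Sum>i=1..n+1. (y i)\<^sup>2)"
    using N by (simp only: mult_less_cancel_left_pos)
  then have "(l / N) * ((real m - 1) / l * N * (\<Sum>i=1..n+1. (w i \<bullet> v) ^ (m - 2) * (y i)\<^sup>2))
      < (l / N) * (\<Sum>i=1..n+1. (y i)\<^sup>2)"
    using l N by (intro mult_strict_left_mono) auto
  moreover have "(l / N) * ((real m - 1) / l * N * z) = (real m - 1) * z" for z using l N by simp
  ultimately have "(real m - 1) * (\<Sum>i=1..n+1. (w i \<bullet> v) ^ (m - 2) * (y i)\<^sup>2)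
      < (l / N) * (\<Sum>i=1..n+1. (y i)\<^sup>2)" by simp
  moreover have "l / N = real n * l / (real n + 1)" by (simp add: N_def)
  moreover have "real (m - 1) = real m - 1" "m - 1 - 1 = m - 2" using m by auto
  ultimately show ?thesis
    by (simp only: left_diff_distrib sum_subtractf mult.assoc sum_distrib_left[symmetric])
qed

text \<open>For even order the eigenvalue is \<open>\<Sum> x\<^sub>i\<^sup>m\<close>, a sum of even powers; for odd order the sign is a convention.\<close>

lemma robust_eigenvalue_pos:
  assumes m: "m \<ge> 3" and pair: "eigenpair n m (simplex_tensor n w) l v" and "odd m \<longrightarrow> 0 \<le> l" "l \<noteq> 0"
  shows "l > 0"
proof (cases "even m")
  case True
  have v: "v \<in> carrier_vec n" "tensor_vec n m (simplex_tensor n w) v = l \<cdot>\<^sub>v v" "v \<bullet> v = 1"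
    using pair by (auto simp: eigenpair_def)
  have "l = v \<bullet> tensor_vec n m (simplex_tensor n w) v" using v by simp
  also have "\<dots> = (\<Sum>i=1..n+1. (w i \<bullet> v) ^ (m - 1) * (v \<bullet> w i))"
    unfolding simplex_tensor_vec[OF v(1)] by (rule combination_scalar_prod[OF v(1)])
  also have "\<dots> = (\<Sum>i=1..n+1. (w i \<bullet> v) ^ m)"
    using m comm_scalar_prod[OF v(1) w_carrier]
    by (intro sum.cong refl) (simp add: power_eq_if[of _ m] mult.commute)
  also have "\<dots> \<ge> 0" using True by (intro sum_nonneg) (simp add: zero_le_even_power)
  finally show ?thesis using assms by simp
qed (use assms in simp)

lemma robust_imp_frame_vector:
  assumes m: "m \<ge> 3" and rob: "robust_eigenvector n m (simplex_tensor n w) v"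
  shows "\<exists>i\<in>{1..n+1}. same_eigenvector m v (w i)"
proof -
  obtain l where pair: "eigenpair n m (simplex_tensor n w) l v" and "odd m \<longrightarrow> 0 \<le> l" "l \<noteq> 0"
    and sr: "spectral_radius (map_mat complex_of_real (power_jacobian n m (simplex_tensor n w) l v)) < 1"
    using rob unfolding robust_eigenvector_def by blast
  then have l: "l > 0" using robust_eigenvalue_pos[OF m] by blast
  have v: "v \<in> carrier_vec n" "v \<bullet> v = 1" using pair by (auto simp: eigenpair_def)
  define x where "x i = w i \<bullet> v" for i
  define \<mu> where "\<mu> = real n * l / (real n + 1)"
  define c where "c = (\<Sum>i=1..n+1. x i ^ (m - 1)) / (real n + 1)"
  have \<mu>: "\<mu> > 0" using l n2 by (simp add: \<mu>_def)
  have root: "x k ^ (m - 1) = \<mu> * x k + c" if "k \<in> {1..n+1}" for k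
    using eigenpair_coordinates[OF pair that] unfolding x_def \<mu>_def c_def .
  have second: "(\<Sum>k=1..n+1. (real (m - 1) * x k ^ (m - 1 - 1) - \<mu>) * (y k)\<^sup>2) < 0"
    if "(\<Sum>k=1..n+1. y k) = 0" "(\<Sum>k=1..n+1. x k * y k) = 0" "\<exists>k\<in>{1..n+1}. y k \<noteq> 0" for y
    using robust_second_order[OF m pair l sr that(1) _ that(3)] that(2) unfolding x_def \<mu>_def by blast
  have sum0: "(\<Sum>k=1..n+1. x k) = 0" unfolding x_def by (rule coordinate_sum_zero[OF v(1)])
  have sumsq: "(\<Sum>k=1..n+1. x k * x k) = (real n + 1) / real n"
    unfolding x_def using parseval[OF v(1) v(1)] v(2) by (simp only: mult_1_right)
  have "\<exists>i\<in>{1..n+1}. x i \<noteq> x 1"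
  proof (rule ccontr)
    assume "\<not> ?thesis"
    then have const: "x i = x 1" if "i \<in> {1..n+1}" for i using that by blast
    then have "(\<Sum>k=1..n+1. x k) = (\<Sum>k=1..n+1. x 1)" by (rule sum.cong[OF refl])
    then have "(1 + real n) * x 1 = 0" using sum0 by (simp add: algebra_simps)
    then have "x 1 = 0" by simp
    then have "x k = 0" if "k \<in> {1..n+1}" for k using const[OF that] by simp
    then have "(\<Sum>k=1..n+1. x k * x k) = 0" by (intro sum.neutral) simp
    then show False using sumsq n2 by simp
  qed
  then obtain j where j: "j \<in> {1..n+1}" "x j \<noteq> x 1" by blast
  have "\<exists>i\<in>{1..n+1}. \<exists>b. \<forall>k\<in>{1..n+1}. k \<noteq> i \<longrightarrow> x k = b"
  proof (rule one_exceptional_coordinate[of "{1..n+1}" "m - 1" x \<mu> c j 1])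
    show "m - 1 \<ge> 2" using m by simp
    show "x k ^ (m - 1) = \<mu> * x k + c" if "k \<in> {1..n+1}" for k by (rule root[OF that])
    show "(\<Sum>k=1..n+1. (real (m - 1) * x k ^ (m - 1 - 1) - \<mu>) * (y k)\<^sup>2) < 0"
      if "(\<Sum>k=1..n+1. y k) = 0" "(\<Sum>k=1..n+1. x k * y k) = 0" "\<exists>k\<in>{1..n+1}. y k \<noteq> 0" for y
      by (rule second[OF that])
    show "\<exists>i\<in>{1..n+1}. \<exists>b. \<forall>k\<in>{1..n+1}. k \<noteq> i \<longrightarrow> x k = b"
      if "i \<in> {1..n+1}" "\<And>k. k \<in> {1..n+1} \<Longrightarrow> k \<noteq> i \<Longrightarrow> x k = b" for i b
      using that by blast
  qed (use j in simp_all)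
  then obtain i b where i: "i \<in> {1..n+1}" and b: "\<And>k. k \<in> {1..n+1} \<Longrightarrow> k \<noteq> i \<Longrightarrow> x k = b"
    by blast
  have split: "(\<Sum>k=1..n+1. g (x k)) = g (x i) + real n * g b" for g :: "real \<Rightarrow> real"
  proof -
    have "(\<Sum>k\<in>{1..n+1} - {i}. g (x k)) = (\<Sum>k\<in>{1..n+1} - {i}. g b)" by (intro sum.cong) (auto simp: b)
    also have "\<dots> = real n * g b" using i by simp
    finally show ?thesis using sum.remove[OF finite_atLeastAtMost i, of "\<lambda>k. g (x k)"] by simp
  qed
  have xi: "x i = - real n * b" using split[of "\<lambda>z. z"] sum0 by simp
  have "x i * x i + real n * (b * b) = (real n + 1) / real n" using split[of "\<lambda>z. z * z"] sumsq by simp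
  then have "(x i)\<^sup>2 * (1 + 1 / real n) = 1 + 1 / real n"
    unfolding xi using n2 by (simp add: field_simps power2_eq_square)
  moreover have "1 + 1 / real n > 0" using n2 by (simp add: add_pos_pos)
  ultimately have "(x i)\<^sup>2 = 1" by simp
  then have unit: "x i = 1 \<or> x i = - 1" by (simp add: power2_eq_1_iff)
  have xk: "x k = x i * (w k \<bullet> w i)" if "k \<in> {1..n+1}" for k
    using that i b[OF that] xi n2 by (cases "k = i") (auto simp: w_unit w_angle)
  have vi: "v $ r = x i * w i $ r" if r: "r < n" for r
  proof -
    have "(real n + 1) / real n * v $ r = (\<Sum>k=1..n+1. x k * w k $ r)"
      unfolding x_def by (rule reconstruction[OF v(1) r, symmetric])
    also have "\<dots> = x i * (\<Sum>k=1..n+1. (w k \<bullet> w i) * w k $ r)"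
      unfolding sum_distrib_left by (intro sum.cong refl) (simp add: xk)
    also have "\<dots> = (real n + 1) / real n * (x i * w i $ r)"
      unfolding reconstruction[OF w_carrier[OF i] r] by simp
    finally show ?thesis using n2 by (simp add: divide_simps)
  qed
  have wi: "w i \<in> carrier_vec n" using w_carrier[OF i] .
  \<comment> \<open>If \<open>x i = - 1\<close>, the even power \<open>m - 1\<close> would increase from \<open>- 1\<close> to \<open>1 / n\<close>, with secant slope \<open>\<mu> > 0\<close>.\<close>
  have "x i = 1" if "odd m"
  proof (rule ccontr)
    assume "x i \<noteq> 1"
    then have x1: "x i = - 1" using unit by simp
    then have b1: "b = 1 / real n" using xi n2 by (simp add: field_simps)
    obtain k where k: "k \<in> {1..n+1}" "k \<noteq> i" using n2 i by (intro that[of "if i = 1 then 2 else 1"]) auto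
    have "even (m - 1)" using that by simp
    then have "1 = - \<mu> + c" using root[OF i] x1 by simp
    moreover have "(1 / real n) ^ (m - 1) = \<mu> * (1 / real n) + c" using root[OF k(1)] b[OF k] b1 by simp
    moreover have "(1 / real n) ^ (m - 1) \<le> 1" using n2 by (intro power_le_one) auto
    moreover have "\<mu> * (1 / real n) > 0" using \<mu> n2 by simp
    ultimately show False using \<mu> by linarith
  qed
  then consider "x i = 1" | "x i = - 1" "even m" using unit by blast
  then have "same_eigenvector m v (w i)"
  proof cases
    case 1
    then have "v = w i" using vi v wi by (intro eq_vecI) auto
    then show ?thesis by (simp add: same_eigenvector_def)
  next
    case 2
    then have "v = - w i" using vi v wi by (intro eq_vecI) auto
    then show ?thesis using 2 by (simp add: same_eigenvector_def)
  qed
  then show ?thesis using i by blast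
qed

text \<open>Both admissible vectors \<open>\<sigma> w\<^sub>i\<close>, \<open>\<sigma> = \<plusminus>1\<close>, are treated at once: \<open>\<sigma>\<^sup>m\<^sup>-\<^sup>2 = 1\<close>, so the sign
  disappears from the Jacobian.\<close>

lemma frame_vector_robust:
  assumes m: "m \<ge> 3" and excl: "(n, m) \<notin> {(2, 3), (2, 4), (3, 3)}"
    and i: "i \<in> {1..n+1}" and same: "same_eigenvector m v (w i)"
  shows "robust_eigenvector n m (simplex_tensor n w) v"
proof -
  let ?S = "simplex_tensor n w"
  define q where "q = - 1 / real n"
  define l where "l = 1 - q ^ (m - 1)"
  define \<kappa> where "\<kappa> = (real m - 1) / l * (q ^ (m - 2) * ((real n + 1) / real n))"
  have wi: "w i \<in> carrier_vec n" using w_carrier[OF i] .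
  obtain \<sigma> :: real where \<sigma>: "v = \<sigma> \<cdot>\<^sub>v w i" "\<sigma> * \<sigma> = 1" "\<sigma> ^ (m - 1) = \<sigma>" "\<sigma> ^ (m - 2) = 1"
  proof (cases "v = w i")
    case True
    then show ?thesis by (intro that[of 1]) auto
  next
    case False
    then have "even m" "v = - w i" using same by (auto simp: same_eigenvector_def)
    moreover have "odd (m - 1)" "even (m - 2)" using \<open>even m\<close> m by auto
    ultimately show ?thesis by (intro that[of "- 1"]) auto
  qed
  have v: "v \<in> carrier_vec n" unfolding \<sigma> using wi by simp
  have vv: "v \<bullet> v = 1" unfolding \<sigma> using wi w_unit[OF i] \<sigma>(2) by simp
  have coord: "w k \<bullet> v = \<sigma> * (w k \<bullet> w i)" if "k \<in> {1..n+1}" for k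
    unfolding \<sigma> using w_carrier[OF that] wi by simp
  have gt: "(m - 1) * (n + 1) + 1 < n ^ (m - 1)"
  proof (rule linear_less_power[OF n2])
    show "m - 1 \<ge> 2" using m by simp
    have "m = Suc (m - 1)" using m by simp
    then show "(n, m - 1) \<notin> {(2, 2), (2, 3), (3, 2)}" using excl by auto
  qed
  have gt': "(real m - 1) * (real n + 1) + 1 < real n ^ (m - 1)"
  proof -
    have "real ((m - 1) * (n + 1) + 1) < real (n ^ (m - 1))" using gt by (rule of_nat_less_iff[THEN iffD2])
    then have "real (m - 1) * (real n + 1) + 1 < real n ^ (m - 1)"
      by (simp only: of_nat_mult of_nat_add of_nat_power of_nat_1)
    moreover have "real (m - 1) = real m - 1" using m by simp
    ultimately show ?thesis by (simp only:)
  qed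
  have absq: "\<bar>q ^ e\<bar> = 1 / real n ^ e" for e by (simp add: q_def power_abs power_one_over)
  have npos: "real n ^ (m - 1) > 0" using n2 by simp
  have l_ge: "l \<ge> 1 - 1 / real n ^ (m - 1)" unfolding l_def using absq[of "m - 1"] by linarith
  have key: "(real m - 1) * (real n + 1) / real n ^ (m - 1) < l"
  proof -
    have "(real m - 1) * (real n + 1) / real n ^ (m - 1) < (real n ^ (m - 1) - 1) / real n ^ (m - 1)"
      using gt' npos by (intro divide_strict_right_mono) auto
    also have "\<dots> = 1 - 1 / real n ^ (m - 1)" using n2 by (simp add: diff_divide_distrib)
    finally show ?thesis using l_ge by simp
  qed
  moreover have "(real m - 1) * (real n + 1) / real n ^ (m - 1) > 0" using m npos by simp
  ultimately have l: "l > 0" by linarith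
  have kappa: "\<bar>\<kappa>\<bar> < 1"
  proof -
    have "m - 1 = Suc (m - 2)" using m by simp
    then have "real n ^ (m - 1) = real n * real n ^ (m - 2)" by simp
    then have "\<bar>\<kappa>\<bar> = (real m - 1) * (real n + 1) / real n ^ (m - 1) / l"
      unfolding \<kappa>_def abs_mult absq using m l by (simp add: abs_mult)
    also have "\<dots> < 1" using key l by (simp only: divide_less_eq_1_pos)
    finally show ?thesis .
  qed
  have pair: "eigenpair n m ?S l v"
  proof -
    have "(\<Sum>k=1..n+1. (w k \<bullet> v) ^ (m - 1) * w k $ r) = l * v $ r" if r: "r < n" for r
    proof -
      have "(\<Sum>k=1..n+1. (w k \<bullet> v) ^ (m - 1) * w k $ r) = \<sigma> * (\<Sum>k=1..n+1. (w k \<bullet> w i) ^ (m - 1) * w k $ r)"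
        unfolding sum_distrib_left by (intro sum.cong refl) (simp only: coord power_mult_distrib \<sigma>(3) mult.assoc)
      also have "\<dots> = \<sigma> * (l * w i $ r)"
        unfolding angle_power_sum[OF i] frame_sum_zero[OF r] l_def q_def by simp
      finally show ?thesis using wi r by (simp add: \<sigma>(1))
    qed
    then have "tensor_vec n m ?S v = l \<cdot>\<^sub>v v"
      unfolding simplex_tensor_vec[OF v] using v by (intro eq_vecI) (auto simp del: sum.cl_ivl_Suc)
    then show ?thesis using v vv by (simp add: eigenpair_def)
  qed
  have jac: "power_jacobian n m ?S l v = \<kappa> \<cdot>\<^sub>m (1\<^sub>m n - outer n (w i))"
  proof (rule eq_matI)
    fix r c assume "r < dim_row (\<kappa> \<cdot>\<^sub>m (1\<^sub>m n - outer n (w i)))" "c < dim_col (\<kappa> \<cdot>\<^sub>m (1\<^sub>m n - outer n (w i)))"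
    then have rc: "r < n" "c < n" by (auto simp: outer_def)
    define W where "W = w i $ r * w i $ c"
    define D where "D = (if r = c then (1 :: real) else 0)"
    have "(\<Sum>k=1..n+1. (w k \<bullet> v) ^ (m - 2) * (w k $ r * w k $ c))
        = (\<Sum>k=1..n+1. (w k \<bullet> w i) ^ (m - 2) * (w k $ r * w k $ c))"
      by (intro sum.cong refl) (simp add: coord power_mult_distrib \<sigma>(4))
    also have "\<dots> = (1 - q ^ (m - 2)) * W + q ^ (m - 2) * ((real n + 1) / real n * D)"
      unfolding angle_power_sum[OF i] resolution[OF rc] q_def W_def D_def by simp
    finally have T: "(\<Sum>k=1..n+1. (w k \<bullet> v) ^ (m - 2) * (w k $ r * w k $ c))
        = (1 - q ^ (m - 2)) * W + q ^ (m - 2) * ((real n + 1) / real n * D)" .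
    have vW: "v $ r * v $ c = W"
    proof -
      have "v $ r * v $ c = (\<sigma> * \<sigma>) * W" using rc wi by (simp add: \<sigma>(1) W_def)
      then show ?thesis by (simp add: \<sigma>(2))
    qed
    have "m - 1 = Suc (m - 2)" using m by simp
    then have lq: "l = 1 - q * q ^ (m - 2)" by (simp add: l_def)
    have q1: "1 - q = (real n + 1) / real n" using n2 by (simp add: q_def field_simps)
    have "power_jacobian n m ?S l v $$ (r, c)
        = (real m - 1) / l * ((1 - q ^ (m - 2)) * W + q ^ (m - 2) * ((1 - q) * D) - l * W)"
      unfolding jacobian_entry[OF v rc] T vW q1 by simp
    also have "(1 - q ^ (m - 2)) * W + q ^ (m - 2) * ((1 - q) * D) - l * W = q ^ (m - 2) * (1 - q) * (D - W)"
      unfolding lq by (simp add: algebra_simps)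
    also have "(real m - 1) / l * (q ^ (m - 2) * (1 - q) * (D - W)) = \<kappa> * (D - W)"
      unfolding \<kappa>_def q1 by (simp only: mult.assoc)
    finally show "power_jacobian n m ?S l v $$ (r, c) = (\<kappa> \<cdot>\<^sub>m (1\<^sub>m n - outer n (w i))) $$ (r, c)"
      using rc by (simp add: outer_def W_def D_def)
  qed (auto simp: power_jacobian_def outer_def)
  have "spectral_radius (map_mat complex_of_real (power_jacobian n m ?S l v)) < 1"
    unfolding jac using spectral_radius_scaled_projection_le[OF _ wi w_unit[OF i], of \<kappa>] kappa n2 by simp
  then show ?thesis unfolding robust_eigenvector_def using pair l by (intro exI[of _ l]) auto
qed

end

theorem mainTheorem1:
  fixes n m :: nat and w :: "nat \<Rightarrow> real vec"
  assumes "n \<ge> 2" and "m \<ge> 3"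
    and "(n, m) \<notin> {(2, 3), (2, 4), (3, 3)}"
    and "simplex_frame n w"
  shows "{v. robust_eigenvector n m (simplex_tensor n w) v}
       = {v. \<exists>i \<in> {1..n+1}. same_eigenvector m v (w i)}"
proof -
  interpret regular_simplex n w using assms by unfold_locales
  show ?thesis using robust_imp_frame_vector frame_vector_robust assms(2,3) by blast
qed

end
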